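(* Let $k>1$ be an odd integer. Then the point $P_k=(m,n,k,i,j)=(2k,2k,k,k,k)$ of the domain is fixed by every element of the Regge group, its value $c_{2k,2k,k}(k,k)$ is the central entry of the $(2k+1)\times(2k+1)$ matrix $M(2k,2k,k)$, and $P_k$ is the center of a 36-pointed star of zeros of $c$ in the five-dimensional domain: $c_{2k,2k,k}(i,j)=0$ at every point of the three diagonals of the polygon of $M(2k,2k,k)$, and for each point $z\neq P_k$ on these diagonals, the orbit of $z$ under the Regge group consists of exactly $36$ points of the domain, at each of which $c$ vanishes.
   Context: The domain is the set of integer tuples $(m,n,k,i,j)$ with $0\le k\le\min(m,n)$, $0\le i\le m$, $0\le j\le n$, $0\le i+j-k\le m+n-2k$. On it define $$c_{m,n,k}(i,j)=\sum_{l=0}^{k}(-1)^l\binom{i+j-k}{i-l}\binom{m-l}{k-l}\binom{n-k+l}{l},$$ where $\binom{a}{b}=0$ if $b<0$ or $b>a$. The matrix $M(m,n,k)$ has $m+1$ rows and $m+n-2k+1$ columns; its entry in row $i+1$ and column $i+j-k+1$ is $c_{m,n,k}(i,j)$ when $0\le j\le n$ and $0$ otherwise; the polygon of $M(m,n,k)$ is the set of positions with $0\le j\le n$. Regge symbols: the domain is in bijection with the $3\times3$ matrices with nonnegative integer entries all of whose rows and columns have the same sum, via $$(m,n,k,i,j)\mapsto\left\|\begin{array}{ccc} n-k & m-k & k\\ i & j & m+n-i-j-k\\ m-i & n-j & i+j-k\end{array}\right\|.$$ The Regge group is the group of order 72 generated by row permutations, column permutations and transposition of such matrices, acting on the domain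 through this bijection. The three diagonals of the polygon of $M(2k,2k,k)$ are the sets of points $(2k,2k,k,i,j)$ of the domain with, respectively, $j=3k-2i$; $i=3k-2j$; $i=j$. They all pass through the central point $P_k$. *)

theory Defs
  imports
    "Jordan_Normal_Form.Matrix"
    "HOL-Algebra.Generated_Groups"
    "HOL-Algebra.Group_Action"
    "HOL-Combinatorics.Permutations"
begin

type_synonym point = "int \<times> int \<times> int \<times> int \<times> int"

definition points :: "point set" where
  "points = {(m, n, k, i, j). 0 \<le> k \<and> k \<le> min m n \<and> 0 \<le> i \<and> i \<le> m \<and> 0 \<le> j \<and> j \<le> n \<and>
     0 \<le> i + j - k \<and> i + j - k \<le> m + n - 2 * k}"

definition binom :: "int \<Rightarrow> int \<Rightarrow> int" where
  "binom a b = (if b < 0 \<or> b > a then 0 else int (nat a choose nat b))"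

fun c_val :: "point \<Rightarrow> int" where
  "c_val (m, n, k, i, j) =
     (\<Sum>l = 0..k. (- 1) ^ nat l * binom (i + j - k) (i - l) * binom (m - l) (k - l) * binom (n - k + l) l)"


(* Matrix indices start at 0, so the entry (r, s) is the one in row r + 1 and column s + 1:
   i = r, i + j - k = s and therefore j = s + k - r. *)

definition polygon :: "int \<Rightarrow> int \<Rightarrow> int \<Rightarrow> (nat \<times> nat) set" where
  "polygon m n k = {(r, s). r < nat (m + 1) \<and> s < nat (m + n - 2 * k + 1) \<and>
     0 \<le> int s + k - int r \<and> int s + k - int r \<le> n}"

definition c_mat :: "int \<Rightarrow> int \<Rightarrow> int \<Rightarrow> int mat" where
  "c_mat m n k = mat (nat (m + 1)) (nat (m + n - 2 * k + 1))
     (\<lambda>(r, s). if (r, s) \<in> polygon m n k then c_val (m, n, k, int r, int s + k - int r) else 0)"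


definition semimagic :: "int mat set" where
  "semimagic = {A \<in> carrier_mat 3 3. (\<forall>r<3. \<forall>s<3. 0 \<le> A $$ (r, s)) \<and>
     (\<exists>t. (\<forall>r<3. (\<Sum>s<3. A $$ (r, s)) = t) \<and> (\<forall>s<3. (\<Sum>r<3. A $$ (r, s)) = t))}"

fun regge_symbol :: "point \<Rightarrow> int mat" where
  "regge_symbol (m, n, k, i, j) = mat_of_rows_list 3
     [[n - k, m - k, k],
      [i, j, m + n - i - j - k],
      [m - i, n - j, i + j - k]]"

definition permute_rows :: "(nat \<Rightarrow> nat) \<Rightarrow> int mat \<Rightarrow> int mat" where
  "permute_rows p A = mat 3 3 (\<lambda>(r, s). A $$ (p r, s))"

definition permute_cols :: "(nat \<Rightarrow> nat) \<Rightarrow> int mat \<Rightarrow> int mat" where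
  "permute_cols p A = mat 3 3 (\<lambda>(r, s). A $$ (r, p s))"

definition regge_gens :: "(int mat \<Rightarrow> int mat) set" where
  "regge_gens =
     {\<lambda>A\<in>semimagic. permute_rows p A | p. p permutes {..<3}} \<union>
     {\<lambda>A\<in>semimagic. permute_cols p A | p. p permutes {..<3}} \<union>
     {\<lambda>A\<in>semimagic. transpose_mat A}"

(* subgroup_generated silently intersects with the carrier; regge_gens_subset below shows that no
   generator is lost. *)

definition regge_group :: "(int mat \<Rightarrow> int mat) monoid" where
  "regge_group = subgroup_generated (BijGroup semimagic) regge_gens"

definition regge_action :: "(int mat \<Rightarrow> int mat) \<Rightarrow> point \<Rightarrow> point" where
  "regge_action g = (\<lambda>z\<in>points. inv_into points regge_symbol (g (regge_symbol z)))"


definition center :: "int \<Rightarrow> point" where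
  "center k = (2 * k, 2 * k, k, k, k)"

definition diagonal1 :: "int \<Rightarrow> point set" where
  "diagonal1 k = {(2 * k, 2 * k, k, i, j) | i j. (2 * k, 2 * k, k, i, j) \<in> points \<and> j = 3 * k - 2 * i}"

definition diagonal2 :: "int \<Rightarrow> point set" where
  "diagonal2 k = {(2 * k, 2 * k, k, i, j) | i j. (2 * k, 2 * k, k, i, j) \<in> points \<and> i = 3 * k - 2 * j}"

definition diagonal3 :: "int \<Rightarrow> point set" where
  "diagonal3 k = {(2 * k, 2 * k, k, i, j) | i j. (2 * k, 2 * k, k, i, j) \<in> points \<and> i = j}"


lemma lt3: "(\<forall>r<(3::nat). P r) \<longleftrightarrow> P 0 \<and> P 1 \<and> P 2"
  by (auto simp: numeral_3_eq_3 numeral_2_eq_2 less_Suc_eq)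

lemma sum3: "(\<Sum>r<(3::nat). f r) = f 0 + f 1 + (f 2 :: int)"
  by (simp add: numeral_3_eq_3 numeral_2_eq_2)

lemma regge_symbol_index:
  "regge_symbol (m, n, k, i, j) \<in> carrier_mat 3 3"
  "regge_symbol (m, n, k, i, j) $$ (0, 0) = n - k"
  "regge_symbol (m, n, k, i, j) $$ (0, 1) = m - k"
  "regge_symbol (m, n, k, i, j) $$ (0, 2) = k"
  "regge_symbol (m, n, k, i, j) $$ (1, 0) = i"
  "regge_symbol (m, n, k, i, j) $$ (1, 1) = j"
  "regge_symbol (m, n, k, i, j) $$ (1, 2) = m + n - i - j - k"
  "regge_symbol (m, n, k, i, j) $$ (2, 0) = m - i"
  "regge_symbol (m, n, k, i, j) $$ (2, 1) = n - j"
  "regge_symbol (m, n, k, i, j) $$ (2, 2) = i + j - k"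
  by (rule carrier_matI) (simp_all add: mat_of_rows_list_def)

lemma mat3_eqI:
  assumes "A \<in> carrier_mat 3 3" "B \<in> carrier_mat 3 3" "\<forall>r<3. \<forall>s<3. A $$ (r, s) = B $$ (r, s)"
  shows "A = B"
  using assms by (intro eq_matI) auto

lemma bij_betw_regge_symbol: "bij_betw regge_symbol points semimagic"
proof (rule bij_betwI')
  fix x y assume "x \<in> points" "y \<in> points"
  obtain m n k i j where x: "x = (m, n, k, i, j)" by (cases x)
  obtain m' n' k' i' j' where y: "y = (m', n', k', i', j')" by (cases y)
  show "regge_symbol x = regge_symbol y \<longleftrightarrow> x = y"
  proof
    assume e: "regge_symbol x = regge_symbol y"
    have E: "regge_symbol x $$ (r, s) = regge_symbol y $$ (r, s)" for r s using e by simp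
    show "x = y"
      using E[of 0 0] E[of 0 1] E[of 0 2] E[of 1 0] E[of 1 1]
      unfolding x y regge_symbol_index prod.inject by (intro conjI; linarith)
  qed simp
next
  fix x assume "x \<in> points"
  obtain m n k i j where x: "x = (m, n, k, i, j)" by (cases x)
  show "regge_symbol x \<in> semimagic"
    using \<open>x \<in> points\<close>
    unfolding semimagic_def mem_Collect_eq x lt3 sum3 regge_symbol_index points_def prod.case
      min.bounded_iff
    by (intro conjI exI[of _ "m + n - k"] regge_symbol_index(1); linarith)
next
  fix A assume A: "A \<in> semimagic"
  obtain t where t: "A $$ (0, 0) + A $$ (0, 1) + A $$ (0, 2) = t"
     "A $$ (1, 0) + A $$ (1, 1) + A $$ (1, 2) = t"
     "A $$ (2, 0) + A $$ (2, 1) + A $$ (2, 2) = t"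
     "A $$ (0, 0) + A $$ (1, 0) + A $$ (2, 0) = t"
     "A $$ (0, 1) + A $$ (1, 1) + A $$ (2, 1) = t"
     "A $$ (0, 2) + A $$ (1, 2) + A $$ (2, 2) = t"
    using A unfolding semimagic_def lt3 sum3 by blast
  have A3: "A \<in> carrier_mat 3 3" using A by (simp add: semimagic_def)
  have nn: "0 \<le> A $$ (0, 0)" "0 \<le> A $$ (0, 1)" "0 \<le> A $$ (0, 2)"
     "0 \<le> A $$ (1, 0)" "0 \<le> A $$ (1, 1)" "0 \<le> A $$ (1, 2)"
     "0 \<le> A $$ (2, 0)" "0 \<le> A $$ (2, 1)" "0 \<le> A $$ (2, 2)"
    using A unfolding semimagic_def lt3 by blast+
  define x where "x = (A $$ (0, 1) + A $$ (0, 2), A $$ (0, 0) + A $$ (0, 2), A $$ (0, 2),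
    A $$ (1, 0), A $$ (1, 1))"
  have "x \<in> points"
    unfolding x_def points_def mem_Collect_eq prod.case min_less_iff_conj min.bounded_iff
    by (intro conjI; use nn t in linarith)
  moreover have "A = regge_symbol x"
    unfolding x_def
    by (rule mat3_eqI[OF A3 regge_symbol_index(1)], unfold lt3 regge_symbol_index)
      (intro conjI; use t in linarith)
  ultimately show "\<exists>x\<in>points. A = regge_symbol x" by blast
qed

lemma transpose_semimagic: "A \<in> semimagic \<Longrightarrow> transpose_mat A \<in> semimagic"
  by (auto simp: semimagic_def lt3 sum3)

lemma permute_rows_semimagic:
  assumes p: "p permutes {..<3}" and A: "A \<in> semimagic"
  shows "permute_rows p A \<in> semimagic"
proof -
  have lt: "p r < 3" if "r < 3" for r using permutes_in_image[OF p, of r] that by auto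
  have "(\<Sum>r<3. permute_rows p A $$ (r, s)) = (\<Sum>r<3. A $$ (r, s))" if "s < 3" for s
  proof -
    have "(\<Sum>r<3. permute_rows p A $$ (r, s)) = (\<Sum>r<3. A $$ (p r, s))"
      using that by (auto simp: permute_rows_def intro!: sum.cong)
    also have "\<dots> = (\<Sum>r<3. A $$ (r, s))"
      using sum.permute[OF p, of "\<lambda>r. A $$ (r, s)"] by (simp add: o_def)
    finally show ?thesis .
  qed
  moreover have "(\<Sum>s<3. permute_rows p A $$ (r, s)) = (\<Sum>s<3. A $$ (p r, s))" if "r < 3" for r
    using that by (auto simp: permute_rows_def intro!: sum.cong)
  ultimately show ?thesis
    using A lt by (auto simp: semimagic_def) (auto simp: permute_rows_def)
qed

lemma permute_cols_eq:
  assumes "p permutes {..<3}" "A \<in> carrier_mat 3 3"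
  shows "permute_cols p A = transpose_mat (permute_rows p (transpose_mat A))"
proof -
  have lt: "p r < 3" if "r < 3" for r using permutes_in_image[OF assms(1), of r] that by auto
  show ?thesis
    using assms(2) lt by (intro mat3_eqI) (auto simp: permute_cols_def permute_rows_def)
qed

lemma permute_cols_semimagic:
  "p permutes {..<3} \<Longrightarrow> A \<in> semimagic \<Longrightarrow> permute_cols p A \<in> semimagic"
  by (subst permute_cols_eq)
    (auto simp: transpose_semimagic permute_rows_semimagic, auto simp: semimagic_def)

lemma permute_rows_inv:
  assumes p: "p permutes {..<3}" and q: "q permutes {..<3}" and pq: "\<And>r. p (q r) = r"
    and A: "A \<in> carrier_mat 3 3"
  shows "permute_rows q (permute_rows p A) = A"
proof -
  have lt: "q r < 3" if "r < 3" for r using permutes_in_image[OF q, of r] that by auto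
  show ?thesis using A lt pq by (intro mat3_eqI) (auto simp: permute_rows_def)
qed

lemma permute_cols_inv:
  assumes p: "p permutes {..<3}" and q: "q permutes {..<3}" and pq: "\<And>r. p (q r) = r"
    and A: "A \<in> carrier_mat 3 3"
  shows "permute_cols q (permute_cols p A) = A"
proof -
  have lt: "q r < 3" if "r < 3" for r using permutes_in_image[OF q, of r] that by auto
  show ?thesis using A lt pq by (intro mat3_eqI) (auto simp: permute_cols_def)
qed

lemma regge_gens_subset: "regge_gens \<subseteq> carrier (BijGroup semimagic)"
proof -
  have s3: "A \<in> carrier_mat 3 3" if "A \<in> semimagic" for A using that by (simp add: semimagic_def)
  have "bij_betw (permute_rows p) semimagic semimagic" if p: "p permutes {..<3}" for p
    by (rule bij_betw_byWitness[where f' = "permute_rows (inv_into UNIV p)"])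
      (auto simp: s3 permute_rows_semimagic p permutes_inv permute_rows_inv[OF p permutes_inv[OF p]]
        permute_rows_inv[OF permutes_inv[OF p] p] permutes_inverses[OF p])
  moreover have "bij_betw (permute_cols p) semimagic semimagic" if p: "p permutes {..<3}" for p
    by (rule bij_betw_byWitness[where f' = "permute_cols (inv_into UNIV p)"])
      (auto simp: s3 permute_cols_semimagic p permutes_inv permute_cols_inv[OF p permutes_inv[OF p]]
        permute_cols_inv[OF permutes_inv[OF p] p] permutes_inverses[OF p])
  moreover have "bij_betw transpose_mat semimagic semimagic"
    by (rule bij_betw_byWitness[where f' = transpose_mat]) (auto simp: transpose_semimagic)
  ultimately show ?thesis
    by (auto simp: regge_gens_def BijGroup_def Bij_def)
qed

lemma carrier_regge_group: "carrier regge_group = generate (BijGroup semimagic) regge_gens"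
  using regge_gens_subset by (simp add: regge_group_def carrier_subgroup_generated Int_absorb1)

lemma group_regge_group: "group regge_group"
  unfolding regge_group_def by (rule group.group_subgroup_generated[OF group_BijGroup])

lemma carrier_regge_group_subset: "carrier regge_group \<subseteq> Bij semimagic"
  using group.generate_incl[OF group_BijGroup regge_gens_subset]
  by (simp add: carrier_regge_group BijGroup_def)

lemma regge_action_in_Bij:
  assumes "g \<in> Bij semimagic"
  shows "regge_action g \<in> Bij points"
proof -
  have g: "bij_betw g semimagic semimagic" using assms by (simp add: Bij_def)
  have "bij_betw (inv_into points regge_symbol \<circ> (g \<circ> regge_symbol)) points points"
    by (rule bij_betw_trans[OF bij_betw_trans[OF bij_betw_regge_symbol g]
          bij_betw_inv_into[OF bij_betw_regge_symbol]])
  then show ?thesis by (simp add: Bij_def regge_action_def o_def)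
qed

lemma group_action_regge: "group_action regge_group points regge_action"
proof -
  have "regge_action (g \<otimes>\<^bsub>regge_group\<^esub> h) = regge_action g \<otimes>\<^bsub>BijGroup points\<^esub> regge_action h"
    if g: "g \<in> Bij semimagic" and h: "h \<in> Bij semimagic" for g h
  proof -
    have hs: "h (regge_symbol z) \<in> semimagic" if "z \<in> points" for z
      using Bij_imp_funcset[OF h] bij_betwE[OF bij_betw_regge_symbol] that by blast
    have inv: "regge_symbol (inv_into points regge_symbol A) = A" if "A \<in> semimagic" for A
      using bij_betw_inv_into_right[OF bij_betw_regge_symbol that] .
    have mem: "inv_into points regge_symbol A \<in> points" if "A \<in> semimagic" for A
      using bij_betwE[OF bij_betw_inv_into[OF bij_betw_regge_symbol]] that by blast
    have "g \<otimes>\<^bsub>regge_group\<^esub> h = compose semimagic g h"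
      using g h by (simp add: regge_group_def subgroup_generated_def BijGroup_def)
    moreover have "regge_action (compose semimagic g h) =
        compose points (regge_action g) (regge_action h)"
    proof
      fix z show "regge_action (compose semimagic g h) z =
          compose points (regge_action g) (regge_action h) z"
      proof (cases "z \<in> points")
        case True
        then have "regge_symbol z \<in> semimagic"
          using bij_betwE[OF bij_betw_regge_symbol] by blast
        with True show ?thesis
          using inv[OF hs[OF True]] mem[OF hs[OF True]] by (simp add: regge_action_def compose_def)
      qed (simp add: regge_action_def compose_def)
    qed
    ultimately show ?thesis
      using g h by (simp add: BijGroup_def regge_action_in_Bij)
  qed
  then show ?thesis
    unfolding group_action_def group_hom_def group_hom_axioms_def hom_def
    using carrier_regge_group_subset
    by (auto simp: group_regge_group group_BijGroup, auto simp: BijGroup_def intro: regge_action_in_Bij)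
qed

end

theory Submission
  imports Defs "HOL-Computational_Algebra.Polynomial"
begin

text \<open>
  Up to the sign and the nonzero product of the factorials in the last row of the Regge symbol,
  \<open>c\<close> is the coefficient of the monomial with exponent matrix \<open>A\<close> in \<open>det(x)\<^sup>J / J!\<close>, where \<open>A\<close> is
  the symbol and \<open>J\<close> its line sum. This coefficient is invariant under transposition and multiplied
  by \<open>(-1)\<^sup>J\<close> when two columns are exchanged. Hence its zero set is stable under the Regge group, and
  it vanishes if \<open>J\<close> is odd and two columns agree. The symbols on the three diagonals are
  \<open>k + a u\<^sub>r v\<^sub>s\<close> with \<open>u = (0, 1, -1)\<close> and \<open>v\<close> an arrangement of \<open>(1, 1, -2)\<close>; here \<open>J = 3k\<close>. Their
  orbit is obtained by rearranging \<open>u\<close> and \<open>v\<close> (6 and 3 ways) and by exchanging their roles.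
\<close>

section \<open>Coefficients of powers of the determinant\<close>

text \<open>
  The decompositions of \<open>A\<close> into permutation matrices: \<open>a\<^sub>t\<close> is the multiplicity of the even
  permutation \<open>r \<mapsto> r + t\<close> and \<open>b\<^sub>t\<close> that of the odd permutation \<open>r \<mapsto> t - r\<close> (modulo 3).
\<close>

definition perm_decomps :: "int mat \<Rightarrow> (nat \<times> nat \<times> nat \<times> nat \<times> nat \<times> nat) set" where
  "perm_decomps A = {(a0, a1, a2, b0, b1, b2).
     A $$ (0, 0) = int (a0 + b0) \<and> A $$ (0, 1) = int (a1 + b1) \<and> A $$ (0, 2) = int (a2 + b2) \<and>
     A $$ (1, 0) = int (a2 + b1) \<and> A $$ (1, 1) = int (a0 + b2) \<and> A $$ (1, 2) = int (a1 + b0) \<and>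
     A $$ (2, 0) = int (a1 + b2) \<and> A $$ (2, 1) = int (a2 + b0) \<and> A $$ (2, 2) = int (a0 + b1)}"

text \<open>Multinomial expansion: each of the J factors of the determinant contributes one of six
  permutation monomials, and the J! of the multinomial coefficient cancels. The exponent of -1
  counts the odd permutations.\<close>

definition det_coeff :: "int mat \<Rightarrow> real" where
  "det_coeff A = (\<Sum>(a0, a1, a2, b0, b1, b2) \<in> perm_decomps A.
     (- 1) ^ (b0 + b1 + b2) / (fact a0 * fact a1 * fact a2 * fact b0 * fact b1 * fact b2))"

text \<open>Transposing inverts the permutations: the two 3-cycles, counted by \<open>a1\<close> and
  \<open>a2\<close>, change places, while the identity and the three transpositions are their own
  inverses.\<close>

lemma det_coeff_transpose:
  assumes "A \<in> carrier_mat 3 3"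
  shows "det_coeff (transpose_mat A) = det_coeff A"
  unfolding det_coeff_def
  by (rule sum.reindex_bij_witness[of _ "\<lambda>(a0, a1, a2, b). (a0, a2, a1, b)"
        "\<lambda>(a0, a1, a2, b). (a0, a2, a1, b)"])
    (use assms in \<open>auto simp: perm_decomps_def mult_ac\<close>)

text \<open>Composing with a transposition exchanges even and odd permutations, so a decomposition
  with s odd permutations becomes one with J - s.\<close>

lemma det_coeff_swap_cols:
  assumes xy: "x < 3" "y < 3" "x \<noteq> y"
  shows "det_coeff (permute_cols (Transposition.transpose x y) A) =
    (- 1) ^ nat (A $$ (0, 0) + A $$ (0, 1) + A $$ (0, 2)) * det_coeff A"
proof -
  define J where "J = nat (A $$ (0, 0) + A $$ (0, 1) + A $$ (0, 2))"
  \<comment> \<open>Here \<open>s\<close> and \<open>t\<close> are the numbers of odd permutations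
    before and after the exchange; every permutation meets row 0 once, hence J = s + t.\<close>
  have sgn: "(- 1) ^ J * (- 1) ^ s / d = (- 1) ^ t / (e :: real)"
    if "A $$ (0, 0) + A $$ (0, 1) + A $$ (0, 2) = int (s + t)" "d = e" for s t d e
  proof -
    have "J = s + t" using that(1) by (simp add: J_def)
    then show ?thesis by (simp add: power_add that(2) mult.assoc mult.left_commute)
  qed
  let ?t = "Transposition.transpose x y"
  \<comment> \<open>In both families the permutation with index t sends row 0 to column t. So the
    indices move like the columns, by \<open>w\<close>, in addition to the exchange of the two
    families; the resulting map \<open>?f\<close> is an involution.\<close>
  have key: ?thesis
    if "(?t 0, ?t 1, ?t 2) = (1, 0, 2) \<and> (\<forall>a0 a1 a2. w (a0, a1, a2) = (a1, a0, a2)) \<or>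
      (?t 0, ?t 1, ?t 2) = (2, 1, 0) \<and> (\<forall>a0 a1 a2. w (a0, a1, a2) = (a2, a1, a0)) \<or>
      (?t 0, ?t 1, ?t 2) = (0, 2, 1) \<and> (\<forall>a0 a1 a2. w (a0, a1, a2) = (a0, a2, a1))"
    for w :: "nat \<times> nat \<times> nat \<Rightarrow> nat \<times> nat \<times> nat"
  proof -
    let ?f = "\<lambda>(a0, a1, a2, b). case (w b, w (a0, a1, a2)) of
      ((c0, c1, c2), d) \<Rightarrow> (c0, c1, c2, d)"
    show ?thesis
      unfolding det_coeff_def J_def[symmetric] sum_distrib_left
      by (rule sum.reindex_bij_witness[of _ ?f ?f])
        (use that in \<open>auto simp: perm_decomps_def permute_cols_def intro!: sgn\<close>)
  qed
  have "x \<in> {0, 1, 2}" "y \<in> {0, 1, 2}"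
    using xy by auto
  then consider "(?t 0, ?t 1, ?t 2) = (1, 0, 2)" | "(?t 0, ?t 1, ?t 2) = (2, 1, 0)" |
      "(?t 0, ?t 1, ?t 2) = (0, 2, 1)"
    using xy(3) by (auto simp: Transposition.transpose_def)
  then show ?thesis
  proof cases
    case 1
    then show ?thesis using key[of "\<lambda>(a0, a1, a2). (a1, a0, a2)"] by simp
  next
    case 2
    then show ?thesis using key[of "\<lambda>(a0, a1, a2). (a2, a1, a0)"] by simp
  next
    case 3
    then show ?thesis using key[of "\<lambda>(a0, a1, a2). (a0, a2, a1)"] by simp
  qed
qed

section \<open>Reduction of c to a determinant coefficient\<close>

text \<open>Both sides equal \<open>(1 + x)\<^bsup>m-k\<^esup> (1 + y)\<^bsup>n-k\<^esup> (y - x)\<^sup>k\<close>, since \<open>(1 + x) y - x (1 + y) = y - x\<close>.\<close>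

lemma sum_transvectant_ring:
  fixes x y :: "'a :: comm_ring_1"
  assumes "k \<le> m" "k \<le> n"
  shows "(\<Sum>l\<le>k. of_int ((- 1) ^ l * int (k choose l)) * (x ^ l * (1 + x) ^ (m - l)) *
        (y ^ (k - l) * (1 + y) ^ (n - k + l))) =
     (\<Sum>l\<le>k. of_int ((- 1) ^ l * int (k choose l)) * (x ^ l * (1 + x) ^ (m - k)) *
        (y ^ (k - l) * (1 + y) ^ (n - k)))"
    (is "?L = ?R")
proof -
  let ?c = "(1 + x) ^ (m - k) * (1 + y) ^ (n - k)"
  have "?L = ?c * (\<Sum>l\<le>k. of_nat (k choose l) * (- x * (1 + y)) ^ l * ((1 + x) * y) ^ (k - l))"
    unfolding sum_distrib_left
  proof (rule sum.cong)
    fix l assume "l \<in> {..k}"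
    then have "m - l = (m - k) + (k - l)" using assms by simp
    then show "of_int ((- 1) ^ l * int (k choose l)) * (x ^ l * (1 + x) ^ (m - l)) *
        (y ^ (k - l) * (1 + y) ^ (n - k + l)) =
      ?c * (of_nat (k choose l) * (- x * (1 + y)) ^ l * ((1 + x) * y) ^ (k - l))"
      by (simp add: power_add power_mult_distrib power_minus[of "x * (1 + y)"] mult_ac)
  qed simp
  also have "\<dots> = ?c * (- x * (1 + y) + (1 + x) * y) ^ k"
    by (simp only: binomial_ring)
  also have "- x * (1 + y) + (1 + x) * y = - x + y"
    by (simp add: algebra_simps)
  also have "?c * (- x + y) ^ k = ?R"
    unfolding binomial_ring[of "- x"] sum_distrib_left
    by (rule sum.cong) (simp_all add: power_minus[of x] mult_ac)
  finally show ?thesis .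
qed

text \<open>Stated over any commutative ring, as it is applied to both levels of
  \<open>int poly poly\<close>.\<close>

lemma coeff_X_power_mult_one_plus_X_power:
  "coeff ([:0, 1:] ^ l * [:1, 1:] ^ N) i =
    (if l \<le> i then of_nat (N choose (i - l)) else (0 :: 'a :: comm_ring_1))"
proof -
  have "[:0, 1 :: 'a:] ^ l = monom 1 l"
    by (simp add: monom_altdef)
  moreover have "coeff ([:1, 1 :: 'a:] ^ N) r = of_nat (N choose r)" for r
  proof (cases "r \<le> N")
    case False
    have "degree ([:1, 1 :: 'a:] ^ N) \<le> N"
      using degree_power_le[of "[:1, 1 :: 'a:]" N] by simp
    with False show ?thesis by (simp add: coeff_eq_0 binomial_eq_0)
  qed (simp add: coeff_linear_poly_power)
  ultimately show ?thesis
    by (simp add: coeff_monom_mult)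
qed

text \<open>Compare the coefficients of x^i y^j in the preceding ring identity, with x the inner and
  y the outer variable.\<close>

lemma sum_transvectant_binomial:
  assumes "k \<le> m" "k \<le> n"
  shows "(\<Sum>l\<le>k. (- 1) ^ l * int (k choose l) *
        (if l \<le> i then int ((m - l) choose (i - l)) else 0) *
        (if k - l \<le> j then int ((n - k + l) choose (j - (k - l))) else 0)) =
     (\<Sum>l\<le>k. (- 1) ^ l * int (k choose l) *
        (if l \<le> i then int ((m - k) choose (i - l)) else 0) *
        (if k - l \<le> j then int ((n - k) choose (j - (k - l))) else 0))"
proof -
  define x :: "int poly" where "x = [:0, 1:]"
  define y :: "int poly poly" where "y = [:0, 1:]"
  have c: "coeff (coeff (\<Sum>l\<le>k. of_int ((- 1) ^ l * int (k choose l)) * ([:x:] ^ l * (1 + [:x:]) ^ M l) *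
        (y ^ (k - l) * (1 + y) ^ N l)) j) i =
      (\<Sum>l\<le>k. (- 1) ^ l * int (k choose l) * (if l \<le> i then int (M l choose (i - l)) else 0) *
        (if k - l \<le> j then int (N l choose (j - (k - l))) else 0))" for M N
  proof -
    \<comment> \<open>All factors free of y are gathered into one scalar of type
      \<open>int poly\<close>, so that the two coefficients can be taken one after the
      other.\<close>
    have s: "of_int ((- 1) ^ l * int (k choose l)) * ([:x:] ^ l * (1 + [:x:]) ^ M l) * p =
      smult (smult ((- 1) ^ l * int (k choose l)) ([:0, 1:] ^ l * [:1, 1:] ^ M l)) p" for l p
      by (simp add: of_int_poly one_pCons poly_const_pow x_def mult.commute)
    have y1: "1 + y = [:1, 1:]" by (simp add: y_def one_pCons)
    have m: "coeff (p * (if b then of_nat r else 0)) i = coeff p i * (if b then int r else 0)"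
      for p b r by (simp add: of_nat_poly mult.commute[of p])
    show ?thesis
      unfolding s y1 unfolding coeff_sum coeff_smult y_def coeff_X_power_mult_one_plus_X_power m ..
  qed
  show ?thesis
    using arg_cong[OF sum_transvectant_ring[OF assms, of "[:x:]" y], of "\<lambda>p. coeff (coeff p j) i"]
    unfolding c .
qed

text \<open>The nine equations leave one free multiplicity, u = \<open>a2\<close>; the bounds on u
  say that the other five are nonnegative. The number of odd permutations is k + i + (n - j) - 3u,
  which gives the sign.\<close>

lemma det_coeff_regge_symbol:
  assumes "k \<le> m" "k \<le> n" "i \<le> m" "j \<le> n" "k \<le> i + j" "i + j + k \<le> m + n"
  shows "det_coeff (regge_symbol (int m, int n, int k, int i, int j)) =
    (- 1) ^ (k + i + (n - j)) * (\<Sum>u | u \<le> k \<and> u \<le> i \<and> k \<le> j + u \<and> i + k \<le> m + u \<and> j + u \<le> n.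
      (- 1) ^ u / (fact (j + u - k) * fact (m + u - i - k) * fact u *
        fact (n - j - u) * fact (i - u) * fact (k - u)))"
proof -
  have sgn: "(- 1 :: real) ^ (n - j - u + (i - u) + (k - u)) = (- 1) ^ (k + i + (n - j)) * (- 1) ^ u"
    if "u \<le> k" "u \<le> i" "j + u \<le> n" for u
  proof -
    have "even (n - j - u + (i - u) + (k - u) + (k + i + (n - j) + u))"
      using that by (auto simp: even_add)
    then show ?thesis
      unfolding power_add[symmetric] minus_one_power_iff by auto
  qed
  \<comment> \<open>Solved from the entries k, i and n - j, which all contain \<open>a2\<close>, and
    then from j and m - k.\<close>
  let ?t = "\<lambda>u. (j + u - k, m + u - i - k, u, n - j - u, i - u, k - u)"
  have "perm_decomps (regge_symbol (int m, int n, int k, int i, int j)) =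
    ?t ` {u. u \<le> k \<and> u \<le> i \<and> k \<le> j + u \<and> i + k \<le> m + u \<and> j + u \<le> n}" (is "?P = ?t ` ?U")
  proof
    show "?t ` ?U \<subseteq> ?P"
      using assms by (auto simp add: perm_decomps_def regge_symbol_index simp del: regge_symbol.simps One_nat_def)
    show "?P \<subseteq> ?t ` ?U"
    proof
      fix x assume x: "x \<in> ?P"
      obtain a0 a1 a2 b0 b1 b2 where x_eq: "x = (a0, a1, a2, b0, b1, b2)" by (cases x)
      have "x = ?t a2" "a2 \<in> ?U"
        using x assms unfolding x_eq perm_decomps_def regge_symbol_index by auto
      then show "x \<in> ?t ` ?U" by blast
    qed
  qed
  moreover have "inj_on ?t U" for U
    by (auto simp: inj_on_def)
  ultimately show ?thesis
    unfolding det_coeff_def sum_distrib_left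
    by (simp only: sum.reindex)
      (rule sum.cong, simp_all only: o_def prod.case mem_Collect_eq sgn times_divide_eq_right)
qed

section \<open>Binomial coefficients as quotients of factorials\<close>

lemma binom_int: "binom (int a) (int b) = int (a choose b)"
  by (simp add: binom_def binomial_eq_0)

lemma binom_int_diff: "binom (int a) (int b - int c) = (if c \<le> b then int (a choose (b - c)) else 0)"
  by (auto simp: binom_def binomial_eq_0 nat_diff_distrib' of_nat_diff)

text \<open>The conditional keeps the value 0 for a negative lower index, which truncated
  subtraction would turn into the lower index 0.\<close>

lemma c_val_eq_sum_nat:
  assumes "k \<le> m" "k \<le> n" "k \<le> i + j"
  shows "c_val (int m, int n, int k, int i, int j) =
    (\<Sum>l\<le>k. (- 1) ^ l * (if l \<le> i then int ((i + j - k) choose (i - l)) else 0) *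
      int ((m - l) choose (k - l)) * int ((n - k + l) choose l))"
proof -
  have "c_val (int m, int n, int k, int i, int j) =
    (\<Sum>l\<le>k. (- 1) ^ l * binom (int (i + j - k)) (int i - int l) *
       binom (int (m - l)) (int k - int l) * binom (int (n - k + l)) (int l))"
    unfolding c_val.simps
    by (rule sum.reindex_bij_witness[of _ int nat])
       (use assms in \<open>auto simp: of_nat_diff algebra_simps\<close>)
  then show ?thesis
    by (simp add: binom_int_diff binom_int del: of_nat_add)
qed

text \<open>After cancellation both sides are the same quotient of factorials. The right-hand
  binomials are coefficients of (1 + x)^(m - l) and (1 + y)^(n - k + l), the form in which the ring
  identity applies.\<close>

lemma c_val_term_fact:
  assumes "l \<le> k" "l \<le> i" "k \<le> j + l" "k \<le> m" "k \<le> n" "i \<le> m" "j \<le> n"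
  shows "fact k * fact (m - k) * fact (n - k) *
      (real ((i + j - k) choose (i - l)) * real ((m - l) choose (k - l)) * real ((n - k + l) choose l)) =
    fact (i + j - k) * fact (m - i) * fact (n - j) *
      (real (k choose l) * real ((m - l) choose (i - l)) * real ((n - k + l) choose (j - (k - l))))"
proof -
  have "i + j - k - (i - l) = j - (k - l)" "m - l - (k - l) = m - k" "n - k + l - l = n - k"
    "m - l - (i - l) = m - i" "n - k + l - (j - (k - l)) = n - j"
    using assms by auto
  then show ?thesis
    using assms by (simp add: binomial_fact mult_ac)
qed

text \<open>The six factorials in the denominator are those of the decomposition with
  \<open>a2\<close> = l.\<close>

lemma transvectant_term_fact:
  assumes "l \<le> k" "l \<le> i" "k \<le> j + l" "k \<le> m" "k \<le> n" "i + k \<le> m + l" "j + l \<le> n"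
  shows "real (k choose l) * real ((m - k) choose (i - l)) * real ((n - k) choose (j - (k - l))) =
    fact k * fact (m - k) * fact (n - k) /
      (fact (j + l - k) * fact (m + l - i - k) * fact l * fact (n - j - l) * fact (i - l) * fact (k - l))"
proof -
  have "n - k - (j - (k - l)) = n - j - l" "m - k - (i - l) = m + l - i - k" "j - (k - l) = j + l - k"
    using assms by auto
  then show ?thesis
    using assms by (simp add: binomial_fact mult_ac)
qed

text \<open>Multiplied by \<open>?d\<close>, the summands of c become those on the left of
  \<open>sum_transvectant_binomial\<close>; its right side matches the determinant coefficient term
  by term.\<close>

lemma c_val_eq_det_coeff:
  assumes km: "k \<le> m" and kn: "k \<le> n" and im: "i \<le> m" and jn: "j \<le> n"
    and kij: "k \<le> i + j" and ijk: "i + j + k \<le> m + n"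
  shows "real_of_int (c_val (int m, int n, int k, int i, int j)) =
    (- 1) ^ (k + i + (n - j)) * fact (i + j - k) * fact (m - i) * fact (n - j) *
      det_coeff (regge_symbol (int m, int n, int k, int i, int j))"
proof -
  let ?d = "fact k * fact (m - k) * fact (n - k) :: real"
  let ?e = "fact (i + j - k) * fact (m - i) * fact (n - j) :: real"
  let ?U = "{u. u \<le> k \<and> u \<le> i \<and> k \<le> j + u \<and> i + k \<le> m + u \<and> j + u \<le> n}"
  let ?s = "\<Sum>u\<in>?U. (- 1) ^ u / (fact (j + u - k) * fact (m + u - i - k) * fact u *
        fact (n - j - u) * fact (i - u) * fact (k - u)) :: real"
  have "?d * real_of_int (c_val (int m, int n, int k, int i, int j)) =
    ?e * real_of_int (\<Sum>l\<le>k. (- 1) ^ l * int (k choose l) *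
        (if l \<le> i then int ((m - l) choose (i - l)) else 0) *
        (if k - l \<le> j then int ((n - k + l) choose (j - (k - l))) else 0))"
    unfolding c_val_eq_sum_nat[OF km kn kij] of_int_sum sum_distrib_left
  proof (rule sum.cong)
    fix l assume l: "l \<in> {..k}"
    show "?d * real_of_int ((- 1) ^ l * (if l \<le> i then int ((i + j - k) choose (i - l)) else 0) *
        int ((m - l) choose (k - l)) * int ((n - k + l) choose l)) =
      ?e * real_of_int ((- 1) ^ l * int (k choose l) *
        (if l \<le> i then int ((m - l) choose (i - l)) else 0) *
        (if k - l \<le> j then int ((n - k + l) choose (j - (k - l))) else 0))"
    proof (cases "l \<le> i \<and> k \<le> j + l")
      case True
      then have "k - l \<le> j" by auto
      with True show ?thesis
        using arg_cong[OF c_val_term_fact[of l k i j m n], of "(*) ((- 1) ^ l)"] l assms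
        by (simp add: mult_ac)
    next
      \<comment> \<open>If l \<le> i but j + l < k, the lower index i - l exceeds i + j - k, so the
        term of c vanishes as well.\<close>
      case False
      then have "l \<le> i \<Longrightarrow> (i + j - k) choose (i - l) = 0"
        using kij by (intro binomial_eq_0) auto
      with False show ?thesis by auto
    qed
  qed simp
  also have "\<dots> = ?e * real_of_int (\<Sum>l\<le>k. (- 1) ^ l * int (k choose l) *
        (if l \<le> i then int ((m - k) choose (i - l)) else 0) *
        (if k - l \<le> j then int ((n - k) choose (j - (k - l))) else 0))"
    unfolding sum_transvectant_binomial[OF km kn] ..
  also have "\<dots> = ?e * (?d * ?s)"
    unfolding of_int_sum sum_distrib_left
  proof (rule sum.mono_neutral_cong_right)
    show "\<forall>l \<in> {..k} - ?U. ?e * real_of_int ((- 1) ^ l * int (k choose l) *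
        (if l \<le> i then int ((m - k) choose (i - l)) else 0) *
        (if k - l \<le> j then int ((n - k) choose (j - (k - l))) else 0)) = 0"
      \<comment> \<open>The first three bounds in \<open>?U\<close> come from the range and the
        conditionals, the last two from the upper indices m - k and n - k.\<close>
      using km kn by (auto simp: binomial_eq_0)
  next
    fix l assume l: "l \<in> ?U"
    then have "k - l \<le> j" by auto
    with l show "?e * real_of_int ((- 1) ^ l * int (k choose l) *
        (if l \<le> i then int ((m - k) choose (i - l)) else 0) *
        (if k - l \<le> j then int ((n - k) choose (j - (k - l))) else 0)) =
      ?e * (?d * ((- 1) ^ l / (fact (j + l - k) * fact (m + l - i - k) * fact l *
        fact (n - j - l) * fact (i - l) * fact (k - l))))"
      using arg_cong[OF transvectant_term_fact[of l k i j m n], of "(*) (?e * (- 1) ^ l)"] km kn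
      by (simp add: mult_ac)
  qed auto
  \<comment> \<open>The sign occurs a second time inside the determinant coefficient, and its square
    is 1.\<close>
  also have "\<dots> = ?d * ((- 1) ^ (k + i + (n - j)) * ?e *
      det_coeff (regge_symbol (int m, int n, int k, int i, int j)))"
    unfolding det_coeff_regge_symbol[OF assms] by simp
  finally show ?thesis by (simp add: mult.assoc)
qed

text \<open>The sign and the factorials relating the two values are nonzero.\<close>

lemma c_val_eq_0_iff:
  assumes "z \<in> points"
  shows "c_val z = 0 \<longleftrightarrow> det_coeff (regge_symbol z) = 0"
proof -
  obtain m n k i j where z: "z = (m, n, k, i, j)" by (cases z)
  have "real_of_int (c_val (int (nat m), int (nat n), int (nat k), int (nat i), int (nat j))) = 0 \<longleftrightarrow>
    det_coeff (regge_symbol (int (nat m), int (nat n), int (nat k), int (nat i), int (nat j))) = 0"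
    by (subst c_val_eq_det_coeff) (use assms in \<open>auto simp: points_def z simp del: c_val.simps regge_symbol.simps\<close>)
  then show ?thesis
    using assms by (simp add: points_def z del: c_val.simps regge_symbol.simps)
qed

section \<open>The Regge group and its orbits\<close>

lemma semimagic_carrier: "A \<in> semimagic \<Longrightarrow> A \<in> carrier_mat 3 3"
  by (simp add: semimagic_def)

lemma permute_rows_eq:
  assumes "p permutes {..<3}" "A \<in> carrier_mat 3 3"
  shows "permute_rows p A = transpose_mat (permute_cols p (transpose_mat A))"
proof -
  have "p r < 3" if "r < 3" for r using permutes_in_image[OF assms(1), of r] that by auto
  then show ?thesis
    using assms(2) by (intro mat3_eqI) (auto simp: permute_cols_def permute_rows_def)
qed

text \<open>Induction over the generated group. Row permutations are column permutations conjugated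
  by transposition, so two kinds of generators suffice.\<close>

lemma regge_group_invariant:
  assumes transp: "\<And>A. A \<in> semimagic \<Longrightarrow> R (transpose_mat A) = R A"
    and cols: "\<And>p A. p permutes {..<3} \<Longrightarrow> A \<in> semimagic \<Longrightarrow> R (permute_cols p A) = R A"
    and g: "g \<in> carrier regge_group" and A: "A \<in> semimagic"
  shows "R (g A) = R A"
proof -
  have rows: "R (permute_rows p A) = R A" if p: "p permutes {..<3}" and A: "A \<in> semimagic" for p A
    using A by (simp add: permute_rows_eq[OF p semimagic_carrier] transp cols p
        transpose_semimagic permute_cols_semimagic)
  have gens: "R (h A) = R A" if "h \<in> regge_gens" "A \<in> semimagic" for h A
    using that by (auto simp: regge_gens_def rows cols transp)
  have "g \<in> generate (BijGroup semimagic) regge_gens"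
    using g by (simp add: carrier_regge_group)
  then show ?thesis using A
  proof (induction arbitrary: A)
    case one
    then show ?case by (simp add: BijGroup_def)
  next
    case (incl h)
    then show ?case by (rule gens)
  next
    case (inv h)
    then have h: "h \<in> Bij semimagic" using regge_gens_subset by (auto simp: BijGroup_def)
    then have b: "bij_betw h semimagic semimagic" by (simp add: Bij_def)
    \<comment> \<open>Invariance under an inverse is invariance under \<open>h\<close> itself, taken
      at the preimage of \<open>A\<close>.\<close>
    have "R (inv_into semimagic h A) = R (h (inv_into semimagic h A))"
      using gens[OF inv(1)] bij_betwE[OF bij_betw_inv_into[OF b]] inv(2) by simp
    then show ?case
      using inv(2) by (simp add: inv_BijGroup[OF h] bij_betw_inv_into_right[OF b])
  next
    case (eng g h)
    have gh: "g \<in> Bij semimagic" "h \<in> Bij semimagic"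
      using eng(1,2) carrier_regge_group_subset by (auto simp: carrier_regge_group)
    then have "h A \<in> semimagic" using Bij_imp_funcset eng.prems by blast
    with gh eng show ?case by (simp add: BijGroup_def compose_def)
  qed
qed

text \<open>A permutation is a product of transpositions, each of which changes the coefficient only
  by a sign.\<close>

lemma det_coeff_eq_0_permute_cols:
  assumes "p permutes {..<3}" "A \<in> carrier_mat 3 3"
  shows "det_coeff (permute_cols p A) = 0 \<longleftrightarrow> det_coeff A = 0"
  using assms(1) finite_lessThan assms(2)
proof (induction p arbitrary: A rule: permutes_induct)
  case id
  then have "permute_cols id A = A" by (intro mat3_eqI) (auto simp: permute_cols_def)
  then show ?case by (simp only:)
next
  case (swap x y p)
  have "p s < 3" if "s < 3" for s using permutes_in_image[OF swap.hyps(4), of s] that by auto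
  then have eq: "permute_cols (Transposition.transpose x y \<circ> p) A =
      permute_cols p (permute_cols (Transposition.transpose x y) A)"
    by (auto simp: permute_cols_def)
  have "permute_cols (Transposition.transpose x y) A \<in> carrier_mat 3 3"
    by (simp add: permute_cols_def)
  from swap.IH[OF this] show ?case
    unfolding eq using swap.hyps by (simp add: det_coeff_swap_cols)
qed

lemma det_coeff_regge_group:
  assumes "g \<in> carrier regge_group" "A \<in> semimagic"
  shows "det_coeff (g A) = 0 \<longleftrightarrow> det_coeff A = 0"
  by (rule regge_group_invariant[where R = "\<lambda>A. det_coeff A = 0"])
    (simp_all add: assms det_coeff_transpose det_coeff_eq_0_permute_cols semimagic_carrier)

text \<open>Exchanging the two columns fixes the matrix but negates its coefficient.\<close>

lemma det_coeff_eq_0_if_equal_cols: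
  assumes xy: "x < 3" "y < 3" "x \<noteq> y" and A: "A \<in> carrier_mat 3 3"
    and eq: "\<And>r. r < 3 \<Longrightarrow> A $$ (r, x) = A $$ (r, y)"
    and odd: "odd (nat (A $$ (0, 0) + A $$ (0, 1) + A $$ (0, 2)))"
  shows "det_coeff A = 0"
proof -
  have "permute_cols (Transposition.transpose x y) A = A"
    using A eq xy by (intro mat3_eqI) (auto simp: permute_cols_def Transposition.transpose_def)
  then show ?thesis
    using det_coeff_swap_cols[OF xy, of A] odd by simp
qed

section \<open>Matrices \<open>k + a * (u r * v s)\<close> and their orbits\<close>

definition outer_mat :: "int \<Rightarrow> int \<Rightarrow> (nat \<Rightarrow> int) \<Rightarrow> (nat \<Rightarrow> int) \<Rightarrow> int mat" where
  "outer_mat k a u v = mat 3 3 (\<lambda>(r, s). k + a * (u r * v s))"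

lemma transpose_outer_mat: "transpose_mat (outer_mat k a u v) = outer_mat k a v u"
  by (auto simp: outer_mat_def mult.commute)

lemma permute_outer_mat:
  assumes "p permutes {..<3}"
  shows "permute_rows p (outer_mat k a u v) = outer_mat k a (u \<circ> p) v"
    and "permute_cols p (outer_mat k a u v) = outer_mat k a u (v \<circ> p)"
proof -
  have "p r < 3" if "r < 3" for r using permutes_in_image[OF assms, of r] that by auto
  then show "permute_rows p (outer_mat k a u v) = outer_mat k a (u \<circ> p) v"
    and "permute_cols p (outer_mat k a u v) = outer_mat k a u (v \<circ> p)"
    by (auto simp: outer_mat_def permute_rows_def permute_cols_def)
qed

text \<open>The second set consists of the transposes of the first.\<close>

definition outer_star :: "int \<Rightarrow> int \<Rightarrow> (nat \<Rightarrow> int) \<Rightarrow> (nat \<Rightarrow> int) \<Rightarrow> int mat set" where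
  "outer_star k a u v =
     {outer_mat k a (u \<circ> p) (v \<circ> q) | p q. p permutes {..<3} \<and> q permutes {..<3}} \<union>
     {outer_mat k a (v \<circ> q) (u \<circ> p) | p q. p permutes {..<3} \<and> q permutes {..<3}}"

lemma outer_star_transpose: "A \<in> outer_star k a u v \<Longrightarrow> transpose_mat A \<in> outer_star k a u v"
  unfolding outer_star_def by (auto simp: transpose_outer_mat)

lemma outer_star_permute_cols:
  assumes "p permutes {..<3}" "A \<in> outer_star k a u v"
  shows "permute_cols p A \<in> outer_star k a u v"
  using assms(2) permutes_compose[OF assms(1)]
  unfolding outer_star_def by (auto simp: permute_outer_mat[OF assms(1)] comp_assoc) blast+

lemma regge_group_compose:
  assumes "g \<in> carrier regge_group" "h \<in> carrier regge_group" "A \<in> semimagic"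
  shows "\<exists>f\<in>carrier regge_group. f A = g (h A)"
proof
  show "g \<otimes>\<^bsub>regge_group\<^esub> h \<in> carrier regge_group"
    by (rule monoid.m_closed[OF group.is_monoid[OF group_regge_group] assms(1,2)])
  show "(g \<otimes>\<^bsub>regge_group\<^esub> h) A = g (h A)"
    using assms carrier_regge_group_subset
    by (auto simp: regge_group_def subgroup_generated_def BijGroup_def compose_def)
qed

text \<open>Membership in the star is an invariant, so the orbit stays inside; conversely a row
  permutation, a column permutation and a transposition reach every member.\<close>

lemma regge_group_outer_star:
  assumes A: "outer_mat k a u v \<in> semimagic"
  shows "(\<lambda>g. g (outer_mat k a u v)) ` carrier regge_group = outer_star k a u v" (is "?O = ?S")
proof
  have "outer_mat k a u v \<in> ?S"
    unfolding outer_star_def using permutes_id[of "{..<3}"] by (auto intro!: exI[of _ id])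
  \<comment> \<open>An invariant needs equivalences; the converse directions come from undoing the
    transposition or the permutation.\<close>
  moreover have "transpose_mat B \<in> ?S \<longleftrightarrow> B \<in> ?S" for B
    using outer_star_transpose[of "transpose_mat B"] outer_star_transpose by auto
  moreover have "permute_cols p B \<in> ?S \<longleftrightarrow> B \<in> ?S"
    if p: "p permutes {..<3}" and B: "B \<in> semimagic" for p B
  proof
    assume "permute_cols p B \<in> ?S"
    then have "permute_cols (inv_into UNIV p) (permute_cols p B) \<in> ?S"
      by (rule outer_star_permute_cols[OF permutes_inv[OF p]])
    then show "B \<in> ?S"
      using permute_cols_inv[OF p permutes_inv[OF p] permutes_inverses(1)[OF p] semimagic_carrier[OF B]]
      by simp
  qed (rule outer_star_permute_cols[OF p])
  ultimately show "?O \<subseteq> ?S"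
    using regge_group_invariant[where R = "\<lambda>B. B \<in> ?S", OF _ _ _ A] by auto
next
  have gen: "h \<in> carrier regge_group" if "h \<in> regge_gens" for h
    using that by (simp add: carrier_regge_group generate.incl)
  have O1: "outer_mat k a (u \<circ> p) (v \<circ> q) \<in> ?O" if p: "p permutes {..<3}" and q: "q permutes {..<3}" for p q
  proof -
    have "(\<lambda>A\<in>semimagic. permute_rows p A) \<in> carrier regge_group"
      "(\<lambda>A\<in>semimagic. permute_cols q A) \<in> carrier regge_group"
      by (rule gen; use p q in \<open>auto simp: regge_gens_def\<close>)+
    from regge_group_compose[OF this A] obtain f where "f \<in> carrier regge_group"
      "f (outer_mat k a u v) = outer_mat k a (u \<circ> p) (v \<circ> q)"
      using A permute_cols_semimagic[OF q A] by (auto simp: permute_outer_mat p q)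
    then show ?thesis by (metis imageI)
  qed
  have "B \<in> ?O \<Longrightarrow> transpose_mat B \<in> ?O" for B
  proof -
    assume "B \<in> ?O"
    then obtain g where g: "g \<in> carrier regge_group" "B = g (outer_mat k a u v)" by auto
    have "B \<in> semimagic" using g A carrier_regge_group_subset Bij_imp_funcset by blast
    moreover have "(\<lambda>A\<in>semimagic. transpose_mat A) \<in> carrier regge_group"
      by (rule gen) (auto simp: regge_gens_def)
    from regge_group_compose[OF this g(1) A] g(2) calculation
    obtain f where "f \<in> carrier regge_group" "f (outer_mat k a u v) = transpose_mat B"
      by auto
    then show "transpose_mat B \<in> ?O" by (metis imageI)
  qed
  from this[OF O1] O1 show "?S \<subseteq> ?O"
    unfolding outer_star_def transpose_outer_mat by blast
qed

section \<open>Counting the members of a star\<close>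

lemma permutes_lessThan_3:
  "(\<lambda>p. (p 0, p 1, p 2)) ` {p. p permutes {..<3::nat}} =
    {(0, 1, 2), (0, 2, 1), (1, 0, 2), (1, 2, 0), (2, 0, 1), (2, 1, 0)}" (is "?L = ?R")
proof
  show "?L \<subseteq> ?R"
  proof
    fix x assume "x \<in> ?L"
    then obtain p where p: "p permutes {..<3}" and x: "x = (p 0, p 1, p 2)" by auto
    have "p r \<in> {0, 1, 2}" if "r < 3" for r
    proof -
      have "p r < 3" using permutes_in_image[OF p, of r] that by simp
      then show ?thesis by auto
    qed
    then have "p 0 \<in> {0, 1, 2}" "p 1 \<in> {0, 1, 2}" "p 2 \<in> {0, 1, 2}" by simp_all
    moreover have "p 0 \<noteq> p 1" "p 0 \<noteq> p 2" "p 1 \<noteq> p 2"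
      using permutes_inj[OF p] by (simp_all add: inj_eq)
    ultimately show "x \<in> ?R" unfolding x by (elim insertE; simp)
  qed
next
  let ?t = "Transposition.transpose :: nat \<Rightarrow> _"
  define L where "L = ?L"
  have L: "(p 0, p 1, p 2) \<in> L" if "p permutes {..<3}" for p
    using that by (auto simp: L_def)
  have s: "?t 0 1 permutes {..<3}" "?t 0 2 permutes {..<3}" "?t 1 2 permutes {..<3}"
    by (auto intro!: permutes_swap_id)
  \<comment> \<open>The six triples arise from the identity, three transpositions and two products
    of transpositions, which are the 3-cycles.\<close>
  have "?R \<subseteq> L"
    using L[OF permutes_id] L[OF s(1)] L[OF s(2)] L[OF s(3)]
      L[OF permutes_compose[OF s(1) s(3)]] L[OF permutes_compose[OF s(3) s(1)]]
    by (simp add: Transposition.transpose_def)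
  then show "?R \<subseteq> ?L" unfolding L_def .
qed

text \<open>Row-major products without the parameters k and a, so that distinct matrices can be
  counted by evaluation.\<close>

fun outer_entries :: "(int \<times> int \<times> int) \<times> (int \<times> int \<times> int) \<Rightarrow> int list" where
  "outer_entries ((x0, x1, x2), (y0, y1, y2)) =
     [x0 * y0, x0 * y1, x0 * y2, x1 * y0, x1 * y1, x1 * y2, x2 * y0, x2 * y1, x2 * y2]"

definition affine_mat :: "int \<Rightarrow> int \<Rightarrow> int list \<Rightarrow> int mat" where
  "affine_mat k a L = mat 3 3 (\<lambda>(r, s). k + a * L ! (3 * r + s))"

lemma outer_mat_eq_affine_mat:
  "outer_mat k a u v = affine_mat k a (outer_entries ((u 0, u 1, u 2), (v 0, v 1, v 2)))"
  by (rule mat3_eqI, unfold lt3) (simp_all add: outer_mat_def affine_mat_def)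

lemma inj_on_affine_mat:
  assumes "a \<noteq> 0"
  shows "inj_on (affine_mat k a) {L. length L = 9}"
proof (rule inj_onI)
  fix L L' assume len: "L \<in> {L. length L = 9}" "L' \<in> {L. length L = 9}"
    and eq: "affine_mat k a L = affine_mat k a L'"
  have "L ! i = L' ! i" if "i < 9" for i
  proof -
    have "affine_mat k a L $$ (i div 3, i mod 3) = affine_mat k a L' $$ (i div 3, i mod 3)"
      by (simp add: eq)
    then show ?thesis using assms that by (simp add: affine_mat_def less_mult_imp_div_less)
  qed
  then show "L = L'" using len by (auto intro: nth_equalityI)
qed

text \<open>Only the finitely many triples of values of the permutations matter, and these are
  enumerated by \<open>permutes_lessThan_3\<close>.\<close>

lemma outer_star_eq_affine_mat:
  "outer_star k a u v = affine_mat k a ` outer_entries `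
    ((\<lambda>(x, y, z). (u x, u y, u z)) ` (\<lambda>p. (p 0, p 1, p 2)) ` {p. p permutes {..<3}} \<times>
     (\<lambda>(x, y, z). (v x, v y, v z)) ` (\<lambda>p. (p 0, p 1, p 2)) ` {p. p permutes {..<3}} \<union>
     (\<lambda>(x, y, z). (v x, v y, v z)) ` (\<lambda>p. (p 0, p 1, p 2)) ` {p. p permutes {..<3}} \<times>
     (\<lambda>(x, y, z). (u x, u y, u z)) ` (\<lambda>p. (p 0, p 1, p 2)) ` {p. p permutes {..<3}})"
proof -
  have t: "(\<lambda>(x, y, z). (w x, w y, w z)) ` (\<lambda>p. (p 0, p 1, p 2)) ` {p. p permutes {..<3}} =
      {(w (p 0), w (p 1), w (p 2)) | p. p permutes {..<3}}" for w :: "nat \<Rightarrow> int"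
    by (auto simp: image_image)
  show ?thesis
    unfolding t image_Un outer_star_def outer_mat_eq_affine_mat o_apply
    by (intro arg_cong2[of _ _ _ _ "(\<union>)"]) blast+
qed

lemma card_outer_star:
  assumes "a \<noteq> 0" "(u 0, u 1, u 2) = (0, 1, - 1)"
    "(v 0, v 1, v 2) \<in> {(1, 1, - 2), (1, - 2, 1), (- 2, 1, 1)}"
  shows "card (outer_star k a u v) = 36"
proof -
  define U :: "(int \<times> int \<times> int) set"
    where "U = {(0, 1, - 1), (0, - 1, 1), (1, 0, - 1), (1, - 1, 0), (- 1, 0, 1), (- 1, 1, 0)}"
  define V :: "(int \<times> int \<times> int) set"
    where "V = {(1, 1, - 2), (1, - 2, 1), (- 2, 1, 1)}"
  have "outer_star k a u v = affine_mat k a ` outer_entries ` (U \<times> V \<union> V \<times> U)"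
  proof -
    have "(\<lambda>(x, y, z). (u x, u y, u z)) ` (\<lambda>p. (p 0, p 1, p 2)) ` {p. p permutes {..<3}} = U"
      unfolding permutes_lessThan_3 U_def using assms(2) by auto
    moreover have "(\<lambda>(x, y, z). (v x, v y, v z)) ` (\<lambda>p. (p 0, p 1, p 2)) ` {p. p permutes {..<3}} = V"
      unfolding permutes_lessThan_3 V_def using assms(3) by (elim insertE emptyE) auto
    ultimately show ?thesis unfolding outer_star_eq_affine_mat by simp
  qed
  \<comment> \<open>Each product contributes 18 matrices, as no two members of V are proportional
    and V is not closed under negation. Those from U \<times> V have a zero row, those from V
    \<times> U have none.\<close>
  moreover have "card (outer_entries ` (U \<times> V \<union> V \<times> U)) = 36"
    unfolding U_def V_def by code_simp
  moreover have "inj_on (affine_mat k a) (outer_entries ` (U \<times> V \<union> V \<times> U))"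
    by (rule inj_on_subset[OF inj_on_affine_mat[OF assms(1)]]) auto
  ultimately show ?thesis by (simp only: card_image)
qed

section \<open>From Regge symbols back to points\<close>

lemma regge_symbol_regge_action:
  assumes "g \<in> carrier regge_group" "z \<in> points"
  shows "regge_symbol (regge_action g z) = g (regge_symbol z)"
proof -
  have "regge_symbol z \<in> semimagic" using assms(2) bij_betwE[OF bij_betw_regge_symbol] by blast
  then have "g (regge_symbol z) \<in> semimagic"
    using assms(1) carrier_regge_group_subset Bij_imp_funcset by blast
  then show ?thesis
    using assms(2) by (simp add: regge_action_def bij_betw_inv_into_right[OF bij_betw_regge_symbol])
qed

lemma regge_action_closed:
  "g \<in> carrier regge_group \<Longrightarrow> z \<in> points \<Longrightarrow> regge_action g z \<in> points"
  using carrier_regge_group_subset regge_action_in_Bij Bij_imp_funcset by blast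

lemma regge_symbol_orbit:
  assumes "z \<in> points"
  shows "regge_symbol ` orbit regge_group regge_action z =
    (\<lambda>g. g (regge_symbol z)) ` carrier regge_group"
  unfolding orbit_def Setcompr_eq_image image_image
  using assms by (intro image_cong) (simp_all only: regge_symbol_regge_action)

lemma orbit_subset_points: "z \<in> points \<Longrightarrow> orbit regge_group regge_action z \<subseteq> points"
  by (auto simp: orbit_def regge_action_closed simp del: split_paired_All)

text \<open>Vanishing of c is vanishing of the determinant coefficient of the symbol, which the
  group preserves.\<close>

lemma c_val_orbit:
  assumes "z \<in> points" "w \<in> orbit regge_group regge_action z"
  shows "c_val w = 0 \<longleftrightarrow> c_val z = 0"
proof -
  obtain g where g: "g \<in> carrier regge_group" "w = regge_action g z"
    using assms(2) by (auto simp: orbit_def)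
  moreover have "regge_symbol z \<in> semimagic"
    using assms(1) bij_betwE[OF bij_betw_regge_symbol] by blast
  ultimately show ?thesis
    using assms(1) by (simp add: c_val_eq_0_iff regge_action_closed regge_symbol_regge_action
        det_coeff_regge_group del: regge_symbol.simps)
qed

section \<open>The three diagonals\<close>

lemma det_coeff_outer_mat_eq_0:
  assumes "x < 3" "y < 3" "x \<noteq> y" "v x = v y" "u 0 = 0" "odd k" "k \<ge> 0"
  shows "det_coeff (outer_mat k a u v) = 0"
proof (rule det_coeff_eq_0_if_equal_cols[OF assms(1-3)])
  show "odd (nat (outer_mat k a u v $$ (0, 0) + outer_mat k a u v $$ (0, 1) + outer_mat k a u v $$ (0, 2)))"
    \<comment> \<open>As \<open>u 0 = 0\<close>, the first row is constantly k and its sum is the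
      odd number 3k.\<close>
    using assms by (simp add: outer_mat_def even_nat_iff)
qed (use assms in \<open>auto simp: outer_mat_def\<close>)

text \<open>The rows of the symbol are k, k + d and k - d with d = (i - k, j - k, 2k - i - j) of sum
  0. Each diagonal makes two entries of d equal, so d is a multiple of an arrangement of (1, 1,
  -2).\<close>

lemma regge_symbol_diagonals:
  assumes "z \<in> diagonal1 k \<union> diagonal2 k \<union> diagonal3 k"
  obtains a u v x y where "regge_symbol z = outer_mat k a u v" "(u 0, u 1, u 2) = (0, 1, - 1)"
    "(v 0, v 1, v 2) \<in> {(1, 1, - 2), (1, - 2, 1), (- 2, 1, 1)}"
    "x < 3" "y < 3" "x \<noteq> y" "v x = v y" "a = 0 \<longrightarrow> z = center k"
proof -
  let ?u = "\<lambda>r. [0, 1, - 1 :: int] ! r"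
  obtain i j where z: "z = (2 * k, 2 * k, k, i, j)"
    and ij: "j = 3 * k - 2 * i \<or> i = 3 * k - 2 * j \<or> i = j"
    using assms by (auto simp: diagonal1_def diagonal2_def diagonal3_def)
  have symbol: "regge_symbol z = outer_mat k a ?u v"
    if "i = k + a * v 0" "j = k + a * v 1" "3 * k - i - j = k + a * v 2" for a v
    unfolding z
    by (rule mat3_eqI[OF regge_symbol_index(1)])
      (use that in \<open>simp_all add: outer_mat_def lt3 regge_symbol_index
        del: regge_symbol.simps One_nat_def\<close>)
  show thesis
    using ij
  proof (elim disjE)
    assume "j = 3 * k - 2 * i"
    then show thesis
      \<comment> \<open>The factor is the repeated entry of d; the last two numbers are the columns
        where it stands.\<close>
      by (intro that[of "i - k" ?u "\<lambda>s. [1, - 2, 1] ! s" 0 2] symbol) (auto simp: z center_def)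
  next
    assume "i = 3 * k - 2 * j"
    then show thesis
      by (intro that[of "j - k" ?u "\<lambda>s. [- 2, 1, 1] ! s" 1 2] symbol) (auto simp: z center_def)
  next
    assume "i = j"
    then show thesis
      by (intro that[of "i - k" ?u "\<lambda>s. [1, 1, - 2] ! s" 0 1] symbol) (auto simp: z center_def)
  qed
qed

theorem theorem2:
  fixes k :: int
  assumes "k > 1" and "odd k"
  shows "center k \<in> points \<and>
    (\<forall>g \<in> carrier regge_group. regge_action g (center k) = center k) \<and>
    c_mat (2 * k) (2 * k) k \<in> carrier_mat (nat (2 * k + 1)) (nat (2 * k + 1)) \<and>
    c_mat (2 * k) (2 * k) k $$ (nat k, nat k) = c_val (center k) \<and>
    center k \<in> diagonal1 k \<inter> diagonal2 k \<inter> diagonal3 k \<and>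
    (\<forall>z \<in> diagonal1 k \<union> diagonal2 k \<union> diagonal3 k. c_val z = 0) \<and>
    (\<forall>z \<in> (diagonal1 k \<union> diagonal2 k \<union> diagonal3 k) - {center k}.
       orbit regge_group regge_action z \<subseteq> points \<and>
       card (orbit regge_group regge_action z) = 36 \<and>
       (\<forall>w \<in> orbit regge_group regge_action z. c_val w = 0))"
proof -
  let ?D = "diagonal1 k \<union> diagonal2 k \<union> diagonal3 k"
  have center: "center k \<in> points"
    using assms by (simp add: center_def points_def)
  then have center_diag: "center k \<in> diagonal1 k \<inter> diagonal2 k \<inter> diagonal3 k"
    by (simp add: center_def diagonal1_def diagonal2_def diagonal3_def)
  have D: "z \<in> points" if "z \<in> ?D" for z
    using that by (auto simp: diagonal1_def diagonal2_def diagonal3_def)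
  have symb: "regge_symbol z \<in> semimagic" if "z \<in> points" for z
    using that bij_betwE[OF bij_betw_regge_symbol] by blast
  have fixed: "regge_action g (center k) = center k" if g: "g \<in> carrier regge_group" for g
  proof -
    \<comment> \<open>All entries of the symbol of the center equal k, the case a = 0, where the
      star shrinks to a single matrix.\<close>
    let ?w = "\<lambda>_. 0 :: int"
    have s: "regge_symbol (center k) = outer_mat k 0 ?w ?w"
      unfolding center_def
      by (rule mat3_eqI[OF regge_symbol_index(1)])
        (simp_all add: outer_mat_def lt3 regge_symbol_index del: regge_symbol.simps One_nat_def)
    have "g (regge_symbol (center k)) \<in> outer_star k 0 ?w ?w"
      using regge_group_outer_star[of k 0 ?w ?w] symb[OF center] g unfolding s by auto
    then have "regge_symbol (regge_action g (center k)) = regge_symbol (center k)"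
      unfolding regge_symbol_regge_action[OF g center] s
      by (auto simp: outer_star_def outer_mat_def)
    then show ?thesis
      using bij_betw_imp_inj_on[OF bij_betw_regge_symbol] regge_action_closed[OF g center] center
      by (simp only: inj_on_eq_iff)
  qed
  have zero: "c_val z = 0" if z: "z \<in> ?D" for z
  proof -
    from z obtain a u v x y where "regge_symbol z = outer_mat k a u v" "(u 0, u 1, u 2) = (0, 1, - 1)"
      "x < 3" "y < 3" "x \<noteq> y" "v x = v y"
      by (rule regge_symbol_diagonals) blast
    then show ?thesis
      using c_val_eq_0_iff[OF D[OF z]] det_coeff_outer_mat_eq_0[of x y v u k a] assms by simp
  qed
  have card: "card (orbit regge_group regge_action z) = 36" if z: "z \<in> ?D - {center k}" for z
  proof -
    from z have zD: "z \<in> ?D" by blast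
    from zD obtain a u v x y where s: "regge_symbol z = outer_mat k a u v" and
      uv: "(u 0, u 1, u 2) = (0, 1, - 1)" "(v 0, v 1, v 2) \<in> {(1, 1, - 2), (1, - 2, 1), (- 2, 1, 1)}"
      and "x < 3" "y < 3" "x \<noteq> y" "v x = v y" and a: "a = 0 \<longrightarrow> z = center k"
      by (rule regge_symbol_diagonals) blast
    have "regge_symbol ` orbit regge_group regge_action z = outer_star k a u v"
      unfolding regge_symbol_orbit[OF D[OF zD]] s
      by (rule regge_group_outer_star) (use symb[OF D[OF zD]] s in simp)
    moreover have "card (outer_star k a u v) = 36"
      \<comment> \<open>The factor a is nonzero because z differs from the center.\<close>
      by (rule card_outer_star[OF _ uv]) (use a z in blast)
    moreover have "inj_on regge_symbol (orbit regge_group regge_action z)"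
      by (rule inj_on_subset[OF bij_betw_imp_inj_on[OF bij_betw_regge_symbol]
            orbit_subset_points[OF D[OF zD]]])
    ultimately show ?thesis by (simp only: card_image[symmetric])
  qed
  have "c_mat (2 * k) (2 * k) k \<in> carrier_mat (nat (2 * k + 1)) (nat (2 * k + 1))"
    by (simp add: c_mat_def)
  \<comment> \<open>Counting from 0, index k is the middle of 2k + 1; row k and column k give i = k
    and j = k + k - k = k.\<close>
  moreover have "c_mat (2 * k) (2 * k) k $$ (nat k, nat k) = c_val (center k)"
    using assms by (simp add: c_mat_def polygon_def center_def)
  moreover have "\<forall>z \<in> ?D - {center k}. orbit regge_group regge_action z \<subseteq> points \<and>
       card (orbit regge_group regge_action z) = 36 \<and>
       (\<forall>w \<in> orbit regge_group regge_action z. c_val w = 0)"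
    using orbit_subset_points card D zero c_val_orbit by blast
  ultimately show ?thesis
    using center fixed center_diag zero by blast
qed

end
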